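(* Let $N \in \mathbb{N}_0$, let $\tau_N$ be the postorder rearrangement on $\mathcal{D}_N$ and $\sigma_N=\tau_N^{-1}$. Let $$R^N(\mathrm{BMO}_N)=\sup\Big\{\|T_{\tau}\colon \mathrm{BMO}_N \rightarrow \mathrm{BMO}_N\| :\ \tau\colon \mathcal{D}_N \rightarrow \mathcal{D}_N \text{ bijective}\Big\}.$$ Then for $T=T_{\tau_N}$ and for $T=T_{\sigma_N}$ we have $$\frac{1}{\sqrt{2}}\,R^N(\mathrm{BMO}_N)\leq \|T\colon \mathrm{BMO}_N\to \mathrm{BMO}_N\|\leq R^N(\mathrm{BMO}_N).$$
   Context: For $N\in\mathbb{N}_0=\{0,1,2,\dots\}$ let $\mathcal{D}_N=\{I_{\ell,k}: 0\le \ell\le N,\ 0\le k\le 2^\ell-1\}$, where $I_{\ell,k}=\left[\frac{k}{2^\ell},\frac{k+1}{2^\ell}\right[$; $|I|$ denotes length. Postorder on $\mathcal{D}_N$: $I\preceq J$ if either $I$ and $J$ are disjoint and $I$ is to the left of $J$, or $I\subseteq J$ (a total order). Lexicographic order on $\mathcal{D}_N$: $I_{\ell,k}\le_l I_{\ell',k'}$ iff $(\ell,k)\le(\ell',k')$ lexicographically. The postorder rearrangement $\tau_N\colon\mathcal{D}_N\to\mathcal{D}_N$ is the bijection mapping the $n$-th interval in postorder to the $n$-th interval in lexicographic order, $1\le n\le 2^{N+1}-1$. $L^\infty$-normalised Haar system: $h_I=1$ on the left half of $I$, $-1$ on the right half of $I$, $0$ otherwise. $\mathrm{BMO}_N$ is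 the space $\mathrm{span}\{h_I: I\in\mathcal{D}_N\}$ (real coefficients) with norm, for $f=\sum_{I\in\mathcal{D}_N}x_Ih_I$, $$\|f\|_{\mathrm{BMO}}=\sup_{I\in\mathcal{D}_N}\Big(\frac{1}{|I|}\sum_{J\subseteq I,\,J\in\mathcal{D}_N}|x_J|^2|J|\Big)^{1/2}.$$ For a bijection $\tau$ of $\mathcal{D}_N$, $T_\tau$ is the linear operator on $\mathrm{BMO}_N$ determined by $T_\tau h_I=h_{\tau(I)}$; its norm is the operator norm. *)

theory Defs
  imports "HOL-Analysis.Analysis"
begin

definition dyadic_interval :: "nat \<Rightarrow> nat \<Rightarrow> real set" where
  "dyadic_interval l k = {real k / 2 ^ l ..< (real k + 1) / 2 ^ l}"

definition dyadic_intervals :: "nat \<Rightarrow> real set set" where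
  "dyadic_intervals N = {dyadic_interval l k | l k. l \<le> N \<and> k < 2 ^ l}"

definition postorder_le :: "real set \<Rightarrow> real set \<Rightarrow> bool" where
  "postorder_le I J \<longleftrightarrow> (I \<inter> J = {} \<and> (\<forall>x\<in>I. \<forall>y\<in>J. x < y)) \<or> I \<subseteq> J"

definition lex_le :: "real set \<Rightarrow> real set \<Rightarrow> bool" where
  "lex_le I J \<longleftrightarrow> (\<exists>l k l' k'. I = dyadic_interval l k \<and> J = dyadic_interval l' k' \<and>
      (l < l' \<or> (l = l' \<and> k \<le> k')))"

text \<open>Both orders are used in their reflexive form, so positions start at 1.\<close>

definition position :: "('a \<Rightarrow> 'a \<Rightarrow> bool) \<Rightarrow> 'a set \<Rightarrow> 'a \<Rightarrow> nat" where
  "position le A a = card {b \<in> A. le b a}"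

definition nth_element :: "('a \<Rightarrow> 'a \<Rightarrow> bool) \<Rightarrow> 'a set \<Rightarrow> nat \<Rightarrow> 'a" where
  "nth_element le A n = (THE a. a \<in> A \<and> position le A a = n)"

definition postorder_rearrangement :: "nat \<Rightarrow> real set \<Rightarrow> real set" where
  "postorder_rearrangement N I =
     nth_element lex_le (dyadic_intervals N) (position postorder_le (dyadic_intervals N) I)"

text \<open>For \<open>I = [a,b[\<close> the midpoint is \<open>(Inf I + Sup I) / 2\<close>.\<close>

definition haar :: "real set \<Rightarrow> real \<Rightarrow> real" where
  "haar I t = (if t \<in> I then (if t < (Inf I + Sup I) / 2 then 1 else - 1) else 0)"

definition haar_sum :: "nat \<Rightarrow> (real set \<Rightarrow> real) \<Rightarrow> real \<Rightarrow> real" where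
  "haar_sum N x = (\<lambda>t. \<Sum>I\<in>dyadic_intervals N. x I * haar I t)"

definition BMO :: "nat \<Rightarrow> (real \<Rightarrow> real) set" where
  "BMO N = range (haar_sum N)"

text \<open>The Haar functions are linearly independent, so the coefficients of an element of
  \<open>BMO N\<close> are unique once they are required to vanish outside \<open>dyadic_intervals N\<close>.\<close>

definition haar_coeff :: "nat \<Rightarrow> (real \<Rightarrow> real) \<Rightarrow> real set \<Rightarrow> real" where
  "haar_coeff N f = (THE x. (\<forall>I. I \<notin> dyadic_intervals N \<longrightarrow> x I = 0) \<and> f = haar_sum N x)"

definition bmo_norm :: "nat \<Rightarrow> (real \<Rightarrow> real) \<Rightarrow> real" where
  "bmo_norm N f =
     (SUP I\<in>dyadic_intervals N.
        sqrt (1 / measure lborel I *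
          (\<Sum>J\<in>{J \<in> dyadic_intervals N. J \<subseteq> I}. \<bar>haar_coeff N f J\<bar>\<^sup>2 * measure lborel J)))"

definition rearrangement_op ::
    "nat \<Rightarrow> (real set \<Rightarrow> real set) \<Rightarrow> (real \<Rightarrow> real) \<Rightarrow> real \<Rightarrow> real" where
  "rearrangement_op N \<tau> f = (\<lambda>t. \<Sum>I\<in>dyadic_intervals N. haar_coeff N f I * haar (\<tau> I) t)"

text \<open>Operator norm of an endomorphism of the normed space \<open>BMO N\<close>. This space is a set of
  functions rather than a type, so \<open>onorm\<close> does not apply.\<close>

definition bmo_opnorm :: "nat \<Rightarrow> ((real \<Rightarrow> real) \<Rightarrow> real \<Rightarrow> real) \<Rightarrow> real" where
  "bmo_opnorm N T = (SUP f\<in>{f \<in> BMO N. bmo_norm N f \<le> 1}. bmo_norm N (T f))"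

definition max_rearrangement_norm :: "nat \<Rightarrow> real" where
  "max_rearrangement_norm N =
     (SUP \<tau>\<in>{\<tau>. bij_betw \<tau> (dyadic_intervals N) (dyadic_intervals N)}.
        bmo_opnorm N (rearrangement_op N \<tau>))"

end

theory Submission
  imports Defs
begin

text \<open>If \<open>f = \<Sum>\<^sub>I x\<^sub>I h\<^sub>I\<close> has norm at most 1, then \<open>x\<^sub>I\<^sup>2 \<le> 1\<close> for all \<open>I\<close> and, since \<open>\<bar>I\<bar> \<ge> 2 ^ -N\<close>,
  \<open>\<Sum>\<^sub>I x\<^sub>I\<^sup>2 \<le> 2 ^ N\<close>. Whatever the bijection, the squared norm of the image is therefore at most the
  sum of the \<open>2 ^ N\<close> largest lengths, which is \<open>N + 2 ^ -N\<close>. Conversely let \<open>f\<close> be the sum of the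
  Haar functions of level \<open>N\<close>. Half of every lexicographic level \<open>l \<ge> 1\<close> is hit by level-\<open>N\<close>
  intervals under the postorder rearrangement, and its inverse maps level \<open>N\<close> onto the unit
  interval and all intervals in its right half; both images of \<open>f\<close> thus have squared norm at least
  \<open>1 + N / 2 \<ge> (N + 2 ^ -N) / 2\<close>.\<close>

section \<open>Dyadic intervals\<close>

text \<open>Over the common denominator \<open>2 ^ (l + d)\<close>, comparing grid points of two
  levels amounts to comparing numerators, which makes integer arithmetic available.\<close>

lemma divide_power2_le_iff:
  fixes a b :: real
  shows "a / 2 ^ (l + d) \<le> b / 2 ^ l \<longleftrightarrow> a \<le> b * 2 ^ d"
    and "b / 2 ^ l \<le> a / 2 ^ (l + d) \<longleftrightarrow> b * 2 ^ d \<le> a"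
    and "a / 2 ^ (l + d) < b / 2 ^ l \<longleftrightarrow> a < b * 2 ^ d"
proof -
  have "b / 2 ^ l = b * 2 ^ d / 2 ^ (l + d)"
    by (simp add: power_add)
  then show "a / 2 ^ (l + d) \<le> b / 2 ^ l \<longleftrightarrow> a \<le> b * 2 ^ d"
    and "b / 2 ^ l \<le> a / 2 ^ (l + d) \<longleftrightarrow> b * 2 ^ d \<le> a"
    and "a / 2 ^ (l + d) < b / 2 ^ l \<longleftrightarrow> a < b * 2 ^ d"
    by (simp_all only: divide_le_cancel divide_less_cancel) simp_all
qed

lemma dyadic_interval_nonempty: "dyadic_interval l k \<noteq> {}"
  by (simp add: dyadic_interval_def divide_strict_right_mono)

lemma Inf_dyadic_interval [simp]: "Inf (dyadic_interval l k) = real k / 2 ^ l"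
  unfolding dyadic_interval_def by (rule cInf_atLeastLessThan) (simp add: divide_strict_right_mono)

lemma Sup_dyadic_interval [simp]: "Sup (dyadic_interval l k) = (real k + 1) / 2 ^ l"
  unfolding dyadic_interval_def by (rule cSup_atLeastLessThan) (simp add: divide_strict_right_mono)

lemma measure_dyadic_interval [simp]: "measure lborel (dyadic_interval l k) = 1 / 2 ^ l"
  by (simp add: dyadic_interval_def divide_right_mono flip: diff_divide_distrib)

text \<open>The length determines the level, and the left endpoint then determines the index. Hence
  index pairs can stand for the sets themselves.\<close>

lemma dyadic_interval_eq_iff [simp]:
  "dyadic_interval l k = dyadic_interval l' k' \<longleftrightarrow> l = l' \<and> k = k'"
proof
  assume eq: "dyadic_interval l k = dyadic_interval l' k'"
  have "1 / (2::real) ^ l = 1 / 2 ^ l'"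
    using arg_cong[OF eq, of "measure lborel"] by simp
  moreover have "real k / 2 ^ l = real k' / 2 ^ l'"
    using arg_cong[OF eq, of Inf] by simp
  ultimately show "l = l' \<and> k = k'"
    by simp
qed auto

lemma dyadic_interval_subset_iff:
  "dyadic_interval l' k' \<subseteq> dyadic_interval l k \<longleftrightarrow>
    real k / 2 ^ l \<le> real k' / 2 ^ l' \<and> (real k' + 1) / 2 ^ l' \<le> (real k + 1) / 2 ^ l"
proof -
  have "real k' / 2 ^ l' < (real k' + 1) / 2 ^ l'"
    by (simp add: divide_strict_right_mono)
  then show ?thesis
    unfolding dyadic_interval_def by auto
qed

lemma dyadic_interval_subset_level:
  assumes "dyadic_interval l' k' \<subseteq> dyadic_interval l k"
  shows "l \<le> l'"
proof -
  have "1 / (2::real) ^ l' \<le> 1 / 2 ^ l"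
    using assms by (simp add: dyadic_interval_subset_iff add_divide_distrib)
  then show ?thesis
    by (simp add: field_simps)
qed

text \<open>In binary, passing from level \<open>l + d\<close> to the ancestor at level
  \<open>l\<close> deletes the last \<open>d\<close> digits of the index.\<close>

lemma grid_point_mem_dyadic_interval_iff:
  "real j / 2 ^ (l + d) \<in> dyadic_interval l k \<longleftrightarrow> j div 2 ^ d = k"
proof -
  have "real j / 2 ^ (l + d) \<in> dyadic_interval l k \<longleftrightarrow>
      real k * 2 ^ d \<le> real j \<and> real j < (real k + 1) * 2 ^ d"
    by (simp add: dyadic_interval_def divide_power2_le_iff)
  also have "\<dots> \<longleftrightarrow> real (k * 2 ^ d) \<le> real j \<and> real j < real ((k + 1) * 2 ^ d)"
    by (simp add: algebra_simps)
  also have "\<dots> \<longleftrightarrow> k * 2 ^ d \<le> j \<and> j < (k + 1) * 2 ^ d"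
    by (simp only: of_nat_le_iff of_nat_less_iff)
  also have "\<dots> \<longleftrightarrow> j div 2 ^ d = k"
    by (auto simp: div_nat_eqI algebra_simps dividend_less_times_div)
  finally show ?thesis .
qed

text \<open>The ancestor at level \<open>l\<close> of the finer interval has index
  \<open>j div 2 ^ d\<close>. Whether this index equals \<open>k\<close>, is smaller or is larger
  decides which alternative holds.\<close>

lemma dyadic_intervals_trichotomy_aux:
  "dyadic_interval (l + d) j \<subseteq> dyadic_interval l k
    \<or> (\<forall>x\<in>dyadic_interval (l + d) j. \<forall>y\<in>dyadic_interval l k. x < y)
    \<or> (\<forall>x\<in>dyadic_interval l k. \<forall>y\<in>dyadic_interval (l + d) j. x < y)"
proof -
  have lower: "real (j div 2 ^ d) / 2 ^ l \<le> real j / 2 ^ (l + d)"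
  proof -
    have "real (j div 2 ^ d * 2 ^ d) \<le> real j"
      by (simp only: of_nat_le_iff div_times_less_eq_dividend)
    then show ?thesis
      by (simp add: divide_power2_le_iff)
  qed
  have upper: "(real j + 1) / 2 ^ (l + d) \<le> (real (j div 2 ^ d) + 1) / 2 ^ l"
  proof -
    have "j + 1 \<le> (j div 2 ^ d + 1) * 2 ^ d"
      using dividend_less_div_times[of "2 ^ d" j] by simp
    then have "real (j + 1) \<le> real ((j div 2 ^ d + 1) * 2 ^ d)"
      by (simp only: of_nat_le_iff)
    then show ?thesis
      unfolding divide_power2_le_iff by (simp add: algebra_simps)
  qed
  consider "j div 2 ^ d = k" | "j div 2 ^ d < k" | "j div 2 ^ d > k"
    by linarith
  then show ?thesis
  proof cases
    case 1
    then show ?thesis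
      using lower upper by (simp add: dyadic_interval_subset_iff)
  next
    case 2
    then have "(real (j div 2 ^ d) + 1) / 2 ^ l \<le> real k / 2 ^ l"
      by (intro divide_right_mono) simp_all
    then show ?thesis
      using upper by (auto simp: dyadic_interval_def)
  next
    case 3
    then have "(real k + 1) / 2 ^ l \<le> real (j div 2 ^ d) / 2 ^ l"
      by (intro divide_right_mono) simp_all
    then show ?thesis
      using lower by (auto simp: dyadic_interval_def)
  qed
qed

lemma dyadic_intervals_trichotomy:
  assumes "I \<in> dyadic_intervals N" "J \<in> dyadic_intervals N"
  shows "I \<subseteq> J \<or> J \<subseteq> I \<or> (\<forall>x\<in>I. \<forall>y\<in>J. x < y) \<or> (\<forall>x\<in>J. \<forall>y\<in>I. x < y)"
proof -
  obtain l k l' k' where I: "I = dyadic_interval l k" and J: "J = dyadic_interval l' k'"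
    using assms by (auto simp: dyadic_intervals_def)
  show ?thesis
  proof (cases "l \<le> l'")
    case True
    then obtain d where "l' = l + d"
      using le_Suc_ex by blast
    then show ?thesis
      using dyadic_intervals_trichotomy_aux[of l d k' k] I J by blast
  next
    case False
    then obtain d where "l = l' + d"
      using le_Suc_ex nat_le_linear by blast
    then show ?thesis
      using dyadic_intervals_trichotomy_aux[of l' d k k'] I J by blast
  qed
qed

section \<open>Enumeration by levels and total lengths\<close>

lemma dyadic_intervals_eq_image:
  "dyadic_intervals N = (\<lambda>(l, k). dyadic_interval l k) ` (SIGMA l:{..N}. {..<2 ^ l})"
  by (auto simp: dyadic_intervals_def image_iff)

lemma inj_on_dyadic_interval: "inj_on (\<lambda>(l, k). dyadic_interval l k) A"
  by (auto simp: inj_on_def)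

lemma finite_dyadic_intervals [simp]: "finite (dyadic_intervals N)"
  by (simp add: dyadic_intervals_eq_image)

lemma sum_dyadic_intervals:
  "(\<Sum>I\<in>dyadic_intervals N. g I) = (\<Sum>l\<le>N. \<Sum>k<2 ^ l. g (dyadic_interval l k))"
  unfolding dyadic_intervals_eq_image
  by (subst sum.reindex[OF inj_on_dyadic_interval]) (simp add: sum.Sigma split_def)

lemma dyadic_interval_in_dyadic_intervals_iff [simp]:
  "dyadic_interval l k \<in> dyadic_intervals N \<longleftrightarrow> l \<le> N \<and> k < 2 ^ l"
  by (auto simp: dyadic_intervals_def)

lemma dyadic_intervals_cases:
  assumes "I \<in> dyadic_intervals N"
  obtains l k where "I = dyadic_interval l k" "l \<le> N" "k < 2 ^ l"
  using assms by (auto simp: dyadic_intervals_def)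

lemma dyadic_intervals_subset_root:
  assumes "I \<in> dyadic_intervals N"
  shows "I \<subseteq> dyadic_interval 0 0"
proof -
  obtain l k where I: "I = dyadic_interval l k" "k < 2 ^ l"
    using assms by (rule dyadic_intervals_cases)
  have "real (k + 1) \<le> real (2 ^ l)"
    using I(2) by (simp only: of_nat_le_iff Suc_le_eq flip: Suc_eq_plus1)
  then show ?thesis
    by (simp add: I dyadic_interval_subset_iff)
qed

text \<open>Intervals of one level are disjoint. In terms of indices, at most the
  \<open>2 ^ d\<close> values from \<open>k * 2 ^ d\<close> to \<open>(k + 1) * 2 ^ d - 1\<close>
  occur at level \<open>l + d\<close>, and none occurs at a level coarser than
  \<open>l\<close>.\<close>

lemma sum_measure_level_subset_le:
  "(\<Sum>k'\<in>{k'. dyadic_interval m k' \<subseteq> dyadic_interval l k}. 1 / 2 ^ m) \<le> (1 / 2 ^ l :: real)"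
proof (cases "l \<le> m")
  case True
  then obtain d where m: "m = l + d"
    using le_Suc_ex by blast
  have "{k'. dyadic_interval m k' \<subseteq> dyadic_interval l k} \<subseteq> {k * 2 ^ d..<(k + 1) * 2 ^ d}"
  proof clarify
    fix k' assume "dyadic_interval m k' \<subseteq> dyadic_interval l k"
    then have "real (k * 2 ^ d) \<le> real k'" "real (k' + 1) \<le> real ((k + 1) * 2 ^ d)"
      unfolding dyadic_interval_subset_iff m divide_power2_le_iff by (simp_all add: algebra_simps)
    then have "k * 2 ^ d \<le> k'" "k' + 1 \<le> (k + 1) * 2 ^ d"
      by (simp_all only: of_nat_le_iff)
    then show "k' \<in> {k * 2 ^ d..<(k + 1) * 2 ^ d}"
      by simp
  qed
  then have "card {k'. dyadic_interval m k' \<subseteq> dyadic_interval l k} \<le> 2 ^ d"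
    using card_mono[of "{k * 2 ^ d..<(k + 1) * 2 ^ d}"] by fastforce
  then have "real (card {k'. dyadic_interval m k' \<subseteq> dyadic_interval l k}) \<le> real (2 ^ d)"
    by (simp only: of_nat_le_iff)
  then show ?thesis
    by (simp add: m power_add field_simps)
next
  case False
  have "\<not> dyadic_interval m k' \<subseteq> dyadic_interval l k" for k'
    using False dyadic_interval_subset_level by blast
  then show ?thesis
    by simp
qed

text \<open>Each of the \<open>N + 1 - l\<close> levels from \<open>l\<close> to \<open>N\<close>
  contributes at most the length of the interval.\<close>

lemma sum_measure_subset_le:
  assumes "l \<le> N"
  shows "(\<Sum>J\<in>{J \<in> dyadic_intervals N. J \<subseteq> dyadic_interval l k}. measure lborel J)
    \<le> (real (N + 1) - real l) / 2 ^ l"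
proof -
  have inner: "(\<Sum>k'<2 ^ m. if dyadic_interval m k' \<subseteq> dyadic_interval l k then 1 / 2 ^ m else 0)
      \<le> (if l \<le> m then 1 / 2 ^ l else (0::real))" for m
  proof (cases "l \<le> m")
    case True
    have "(\<Sum>k'<2 ^ m. if dyadic_interval m k' \<subseteq> dyadic_interval l k then 1 / 2 ^ m else (0::real))
      = (\<Sum>k'\<in>{k' \<in> {..<2 ^ m}. dyadic_interval m k' \<subseteq> dyadic_interval l k}. 1 / 2 ^ m)"
      by (rule sum.inter_filter[symmetric]) simp
    also have "\<dots> \<le> (\<Sum>k'\<in>{k'. dyadic_interval m k' \<subseteq> dyadic_interval l k}. 1 / 2 ^ m)"
    proof (rule sum_mono2)
      \<comment> \<open>A crude bound on the indices suffices here: the monotonicity of the sum only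
        asks for a finite index set.\<close>
      have "{k'. dyadic_interval m k' \<subseteq> dyadic_interval l k} \<subseteq> {..(k + 1) * 2 ^ m}"
      proof clarify
        fix k' assume "dyadic_interval m k' \<subseteq> dyadic_interval l k"
        then have "(real k' + 1) / 2 ^ m \<le> (real k + 1) / 2 ^ l"
          by (simp add: dyadic_interval_subset_iff)
        also have "\<dots> \<le> (real k + 1) / 1"
          by (intro divide_left_mono) simp_all
        finally have "real k' \<le> real ((k + 1) * 2 ^ m)"
          by (simp add: field_simps)
        then show "k' \<le> (k + 1) * 2 ^ m"
          by (simp only: of_nat_le_iff)
      qed
      then show "finite {k'. dyadic_interval m k' \<subseteq> dyadic_interval l k}"
        by (rule finite_subset) simp
    qed auto
    also have "\<dots> \<le> 1 / 2 ^ l"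
      by (rule sum_measure_level_subset_le)
    finally show ?thesis
      by (simp only: True if_True)
  next
    case False
    have "\<not> dyadic_interval m k' \<subseteq> dyadic_interval l k" for k'
      using False dyadic_interval_subset_level by blast
    then show ?thesis
      by simp
  qed
  have "(\<Sum>J\<in>{J \<in> dyadic_intervals N. J \<subseteq> dyadic_interval l k}. measure lborel J)
    = (\<Sum>m\<le>N. \<Sum>k'<2 ^ m. if dyadic_interval m k' \<subseteq> dyadic_interval l k then 1 / 2 ^ m else 0)"
    by (simp add: sum.inter_filter sum_dyadic_intervals cong: if_cong)
  also have "\<dots> \<le> (\<Sum>m\<le>N. if l \<le> m then 1 / 2 ^ l else 0)"
    by (intro sum_mono inner)
  also have "\<dots> = real (card {m \<in> {..N}. l \<le> m}) / 2 ^ l"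
    by (simp flip: sum.inter_filter)
  also have "{m \<in> {..N}. l \<le> m} = {l..N}"
    by auto
  finally show ?thesis
    using assms by (simp add: of_nat_diff)
qed

section \<open>Haar coefficients and the BMO norm\<close>

text \<open>The quotient \<open>j div 2 ^ d\<close> is the index of the ancestor at level
  \<open>l + 1\<close>, that is, of a half of an interval of level \<open>l\<close>. Its parity
  tells the left half from the right half.\<close>

lemma haar_dyadic_interval_grid:
  "haar (dyadic_interval l k) (real j / 2 ^ (l + Suc d)) =
    (if j div 2 ^ Suc d = k then if even (j div 2 ^ d) then 1 else - 1 else 0)"
proof (cases "j div 2 ^ Suc d = k")
  case True
  define i where "i = j div 2 ^ d"
  have i: "i div 2 = k"
    using True by (simp add: i_def mult.commute flip: div_mult2_eq)
  have "real j / 2 ^ (l + Suc d) < (real k / 2 ^ l + (real k + 1) / 2 ^ l) / 2 \<longleftrightarrow>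
      real j < real (2 * k + 1) * 2 ^ d"
    by (simp add: power_add field_simps)
  also have "\<dots> \<longleftrightarrow> real j < real ((2 * k + 1) * 2 ^ d)"
    by (simp add: algebra_simps)
  also have "\<dots> \<longleftrightarrow> j < (2 * k + 1) * 2 ^ d"
    by (simp only: of_nat_less_iff)
  also have "\<dots> \<longleftrightarrow> i < 2 * k + 1"
    by (simp add: i_def div_less_iff_less_mult)
  also have "\<dots> \<longleftrightarrow> even i"
    using i by presburger
  finally show ?thesis
    using True grid_point_mem_dyadic_interval_iff[of j l "Suc d" k]
    by (simp add: haar_def i_def)
next
  case False
  then show ?thesis
    using grid_point_mem_dyadic_interval_iff[of j l "Suc d" k] by (simp add: haar_def)
qed

text \<open>Among the Haar functions of level at most \<open>N\<close>, only that of \<open>I\<close> distinguishes the two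
  halves of an interval \<open>I\<close> of level \<open>N\<close>, so the finest coefficients can be read off first.\<close>

lemma haar_sum_eq_0:
  assumes "haar_sum N x = (\<lambda>_. 0)" "I \<in> dyadic_intervals N"
  shows "x I = 0"
proof -
  have level: "x (dyadic_interval N k) = 0"
    if zero: "haar_sum N x = (\<lambda>_. 0)" and k: "k < 2 ^ N" for N k
  proof -
    \<comment> \<open>The left endpoint and the midpoint of the \<open>k\<close>-th interval of
      level \<open>N\<close>. Haar functions of coarser levels agree at both points and cancel in
      the difference, while that of the interval itself drops from 1 to -1.\<close>
    define s where "s = real (2 * k) / 2 ^ Suc N"
    define t where "t = real (2 * k + 1) / 2 ^ Suc N"
    have diff: "haar (dyadic_interval l i) s - haar (dyadic_interval l i) t =
        (if l = N \<and> i = k then 2 else 0)" if "l \<le> N" for l i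
    proof -
      obtain d where N: "N = l + d"
        using \<open>l \<le> N\<close> le_Suc_ex by blast
      show ?thesis
      proof (cases d)
        case 0
        then show ?thesis
          using haar_dyadic_interval_grid[of l i "2 * k" 0]
            haar_dyadic_interval_grid[of l i "2 * k + 1" 0]
          by (simp only: N s_def t_def) simp
      next
        case (Suc e)
        \<comment> \<open>The two numerators differ only in the last binary digit, which is lost on
          passing to any level at most \<open>N\<close>.\<close>
        have "(2 * k + 1) div 2 ^ Suc m = 2 * k div 2 ^ Suc m" for m
          by (simp add: div_mult2_eq)
        then show ?thesis
          using haar_dyadic_interval_grid[of l i "2 * k" d]
            haar_dyadic_interval_grid[of l i "2 * k + 1" d]
          by (simp only: N s_def t_def Suc) simp
      qed
    qed
    have "0 = haar_sum N x s - haar_sum N x t"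
      by (simp add: zero)
    also have "\<dots> = (\<Sum>l\<le>N. \<Sum>i<2 ^ l. x (dyadic_interval l i) *
        (haar (dyadic_interval l i) s - haar (dyadic_interval l i) t))"
      by (simp add: haar_sum_def sum_dyadic_intervals right_diff_distrib sum_subtractf)
    also have "\<dots> = (\<Sum>l\<le>N. \<Sum>i<2 ^ l.
        if l = N \<and> i = k then 2 * x (dyadic_interval N k) else 0)"
      by (intro sum.cong refl) (auto simp: diff)
    also have "\<dots> = (\<Sum>l\<le>N. if l = N then 2 * x (dyadic_interval N k) else 0)"
      using k by (intro sum.cong refl) auto
    also have "\<dots> = 2 * x (dyadic_interval N k)"
      by simp
    finally show ?thesis
      by simp
  qed
  show ?thesis
    using assms
  proof (induction N)
    case 0
    then show ?case
      using level[of 0] by (auto elim!: dyadic_intervals_cases)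
  next
    case (Suc N)
    have fine: "x (dyadic_interval (Suc N) k) = 0" if "k < 2 ^ Suc N" for k
      using level[OF Suc.prems(1) that] .
    have "haar_sum (Suc N) x = haar_sum N x"
      by (rule ext) (simp add: haar_sum_def sum_dyadic_intervals fine)
    with Suc.prems(1) have coarse: "haar_sum N x = (\<lambda>_. 0)"
      by simp
    obtain l k where I: "I = dyadic_interval l k" "l \<le> Suc N" "k < 2 ^ l"
      using Suc.prems(2) by (rule dyadic_intervals_cases)
    show ?case
    proof (cases "l = Suc N")
      case True
      then show ?thesis
        using I fine by simp
    next
      case False
      then show ?thesis
        using I Suc.IH[OF coarse] by simp
    qed
  qed
qed

text \<open>Two families with the same Haar sum have a difference with sum zero, which vanishes on
  \<open>dyadic_intervals N\<close> by linear independence. The family \<open>y\<close> is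
  \<open>x\<close> normalised to vanish elsewhere, as the definite description demands.\<close>

lemma haar_coeff_haar_sum:
  assumes "I \<in> dyadic_intervals N"
  shows "haar_coeff N (haar_sum N x) I = x I"
proof -
  define y where "y J = (if J \<in> dyadic_intervals N then x J else 0)" for J
  have "haar_coeff N (haar_sum N x) = y"
    unfolding haar_coeff_def
  proof (rule the_equality)
    show "(\<forall>I. I \<notin> dyadic_intervals N \<longrightarrow> y I = 0) \<and> haar_sum N x = haar_sum N y"
      by (auto simp: y_def haar_sum_def)
  next
    fix z assume z: "(\<forall>I. I \<notin> dyadic_intervals N \<longrightarrow> z I = 0) \<and> haar_sum N x = haar_sum N z"
    have "haar_sum N (\<lambda>J. x J - z J) = (\<lambda>t. haar_sum N x t - haar_sum N z t)"
      by (simp add: haar_sum_def left_diff_distrib sum_subtractf)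
    then have "haar_sum N (\<lambda>J. x J - z J) = (\<lambda>_. 0)"
      using z by simp
    then have "x J - z J = 0" if "J \<in> dyadic_intervals N" for J
      using haar_sum_eq_0 that by fast
    with z show "z = y"
      by (auto simp: y_def)
  qed
  then show ?thesis
    using assms by (simp add: y_def)
qed

text \<open>Squaring and clearing the length turns the norm bound into a Carleson condition on the
  coefficients, without suprema, roots or definite descriptions.\<close>

lemma bmo_norm_le_iff:
  assumes "0 \<le> c"
  shows "bmo_norm N (haar_sum N x) \<le> c \<longleftrightarrow>
    (\<forall>I\<in>dyadic_intervals N. (\<Sum>J\<in>{J \<in> dyadic_intervals N. J \<subseteq> I}. (x J)\<^sup>2 * measure lborel J)
      \<le> c\<^sup>2 * measure lborel I)"
proof -
  have "dyadic_interval 0 0 \<in> dyadic_intervals N"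
    by simp
  then have ne: "dyadic_intervals N \<noteq> {}"
    by blast
  define F where "F I = (\<Sum>J\<in>{J \<in> dyadic_intervals N. J \<subseteq> I}. (x J)\<^sup>2 * measure lborel J)" for I
  have "(\<Sum>J\<in>{J \<in> dyadic_intervals N. J \<subseteq> I}.
      \<bar>haar_coeff N (haar_sum N x) J\<bar>\<^sup>2 * measure lborel J) = F I" for I
    unfolding F_def by (intro sum.cong) (auto simp: haar_coeff_haar_sum)
  then have "bmo_norm N (haar_sum N x) = (SUP I\<in>dyadic_intervals N. sqrt (1 / measure lborel I * F I))"
    by (simp only: bmo_norm_def)
  also have "\<dots> \<le> c \<longleftrightarrow> (\<forall>I\<in>dyadic_intervals N. sqrt (1 / measure lborel I * F I) \<le> c)"
    by (intro cSUP_le_iff ne bdd_above_finite finite_imageI finite_dyadic_intervals)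
  also have "\<dots> \<longleftrightarrow> (\<forall>I\<in>dyadic_intervals N. F I \<le> c\<^sup>2 * measure lborel I)"
  proof (intro ball_cong refl)
    fix I assume "I \<in> dyadic_intervals N"
    then have "measure lborel I > 0"
      by (auto elim: dyadic_intervals_cases)
    then show "sqrt (1 / measure lborel I * F I) \<le> c \<longleftrightarrow> F I \<le> c\<^sup>2 * measure lborel I"
      using real_sqrt_le_iff[of "1 / measure lborel I * F I" "c\<^sup>2"] assms
      by (simp add: field_simps)
  qed
  finally show ?thesis
    by (simp only: F_def)
qed

text \<open>Reindexing by \<open>J = \<tau> I\<close> presents the image as a Haar sum again, so
  that the Carleson condition can be applied to it.\<close>

lemma rearrangement_op_haar_sum:
  assumes "bij_betw \<tau> (dyadic_intervals N) (dyadic_intervals N)"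
  shows "rearrangement_op N \<tau> (haar_sum N x) =
    haar_sum N (\<lambda>J. x (inv_into (dyadic_intervals N) \<tau> J))"
proof
  fix t
  have "haar_sum N (\<lambda>J. x (inv_into (dyadic_intervals N) \<tau> J)) t =
      (\<Sum>I\<in>dyadic_intervals N. x (inv_into (dyadic_intervals N) \<tau> (\<tau> I)) * haar (\<tau> I) t)"
    unfolding haar_sum_def by (rule sum.reindex_bij_betw[OF assms, symmetric])
  also have "\<dots> = rearrangement_op N \<tau> (haar_sum N x) t"
    unfolding rearrangement_op_def
    using assms by (intro sum.cong) (auto simp: haar_coeff_haar_sum bij_betw_inv_into_left)
  finally show "rearrangement_op N \<tau> (haar_sum N x) t =
      haar_sum N (\<lambda>J. x (inv_into (dyadic_intervals N) \<tau> J)) t"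
    by simp
qed

section \<open>The maximal rearrangement norm\<close>

text \<open>A fractional form of choosing the \<open>2 ^ N\<close> longest intervals. Each length is
  split into \<open>1 / 2 ^ N\<close> and a nonnegative excess: the bound on the total weight
  handles the first part, the bound \<open>y J \<le> 1\<close> the second. Level \<open>l\<close>
  has total excess \<open>1 - 2 ^ l / 2 ^ N\<close>.\<close>

lemma sum_dyadic_weights_le:
  assumes "\<And>J. J \<in> dyadic_intervals N \<Longrightarrow> 0 \<le> y J \<and> y J \<le> (1::real)"
    and "(\<Sum>J\<in>dyadic_intervals N. y J) \<le> 2 ^ N"
  shows "(\<Sum>J\<in>dyadic_intervals N. y J * measure lborel J) \<le> real N + 1 / 2 ^ N"
proof -
  have len: "1 / 2 ^ N \<le> measure lborel J" if "J \<in> dyadic_intervals N" for J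
    using that by (auto simp: divide_left_mono elim!: dyadic_intervals_cases)
  have "(\<Sum>J\<in>dyadic_intervals N. y J * measure lborel J) =
      (\<Sum>J\<in>dyadic_intervals N. y J) / 2 ^ N +
      (\<Sum>J\<in>dyadic_intervals N. y J * (measure lborel J - 1 / 2 ^ N))"
    by (simp add: sum_divide_distrib right_diff_distrib sum_subtractf)
  also have "\<dots> \<le> 1 + (\<Sum>J\<in>dyadic_intervals N. 1 * (measure lborel J - 1 / 2 ^ N))"
    using assms len by (intro add_mono sum_mono mult_right_mono) (auto simp: field_simps)
  also have "(\<Sum>J\<in>dyadic_intervals N. 1 * (measure lborel J - 1 / 2 ^ N)) =
      (\<Sum>l\<le>N. 1 - 2 ^ l / 2 ^ N)"
    by (simp add: sum_dyadic_intervals right_diff_distrib)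
  also have "\<dots> = real (N + 1) - (\<Sum>l<Suc N. 2 ^ l) / 2 ^ N"
    by (simp add: sum_subtractf sum_divide_distrib lessThan_Suc_atMost)
  also have "(\<Sum>l<Suc N. (2::real) ^ l) = 2 ^ Suc N - 1"
    using geometric_sum[of "2::real" "Suc N"] by simp
  finally show ?thesis
    by (simp add: diff_divide_distrib)
qed

lemma bmo_norm_rearrangement_le:
  assumes bij: "bij_betw \<tau> (dyadic_intervals N) (dyadic_intervals N)"
    and f: "f \<in> BMO N" "bmo_norm N f \<le> 1"
  shows "bmo_norm N (rearrangement_op N \<tau> f) \<le> sqrt (real N + 1 / 2 ^ N)"
proof -
  let ?D = "dyadic_intervals N"
  obtain x where x: "f = haar_sum N x"
    using f(1) by (auto simp: BMO_def)
  have carleson: "(\<Sum>J\<in>{J \<in> ?D. J \<subseteq> I}. (x J)\<^sup>2 * measure lborel J) \<le> measure lborel I"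
    if "I \<in> ?D" for I
    using that f(2) by (simp add: x bmo_norm_le_iff)
  have len: "1 / 2 ^ N \<le> measure lborel J" if "J \<in> ?D" for J
    using that by (auto simp: divide_left_mono elim!: dyadic_intervals_cases)
  \<comment> \<open>The Carleson condition on \<open>J\<close> itself already bounds the single term
    of \<open>J\<close>.\<close>
  have coeff_le: "(x J)\<^sup>2 \<le> 1" if "J \<in> ?D" for J
  proof -
    have "(x J)\<^sup>2 * measure lborel J \<le> (\<Sum>K\<in>{K \<in> ?D. K \<subseteq> J}. (x K)\<^sup>2 * measure lborel K)"
      using that by (intro member_le_sum) auto
    also note carleson[OF that]
    finally have "(x J)\<^sup>2 * measure lborel J \<le> 1 * measure lborel J"
      by simp
    moreover have "measure lborel J > 0"
      using that by (auto elim: dyadic_intervals_cases)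
    ultimately show ?thesis
      by (simp only: mult_le_cancel_right_pos)
  qed
  have "(\<Sum>J\<in>?D. (x J)\<^sup>2 / 2 ^ N) \<le> (\<Sum>J\<in>?D. (x J)\<^sup>2 * measure lborel J)"
  proof (rule sum_mono)
    fix J assume "J \<in> ?D"
    then show "(x J)\<^sup>2 / 2 ^ N \<le> (x J)\<^sup>2 * measure lborel J"
      using mult_left_mono[OF len, of J "(x J)\<^sup>2"] by simp
  qed
  also have "\<dots> = (\<Sum>J\<in>{J \<in> ?D. J \<subseteq> dyadic_interval 0 0}. (x J)\<^sup>2 * measure lborel J)"
    using dyadic_intervals_subset_root by (intro sum.cong) auto
  also have "\<dots> \<le> 1"
    using carleson[of "dyadic_interval 0 0"] by simp
  finally have sum_le: "(\<Sum>J\<in>?D. (x J)\<^sup>2) \<le> 2 ^ N"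
    by (simp add: field_simps flip: sum_divide_distrib)
  \<comment> \<open>Both bounds on \<open>x\<close> are invariant under permutation and hence pass
    to \<open>y\<close>, whereas the Carleson condition in general does not.\<close>
  define y where "y = (\<lambda>J. x (inv_into ?D \<tau> J))"
  have bij': "bij_betw (inv_into ?D \<tau>) ?D ?D"
    using bij by (rule bij_betw_inv_into)
  have y_le: "(y J)\<^sup>2 \<le> 1" if "J \<in> ?D" for J
    unfolding y_def using bij_betwE[OF bij'] that by (intro coeff_le) auto
  have "(\<Sum>J\<in>?D. (y J)\<^sup>2) = (\<Sum>J\<in>?D. (x J)\<^sup>2)"
    unfolding y_def by (rule sum.reindex_bij_betw[OF bij'])
  with sum_le have y_sum: "(\<Sum>J\<in>?D. (y J)\<^sup>2) \<le> 2 ^ N"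
    by simp
  have "bmo_norm N (haar_sum N y) \<le> sqrt (real N + 1 / 2 ^ N)"
  proof (subst bmo_norm_le_iff, simp, rule ballI)
    fix I assume I: "I \<in> ?D"
    then obtain l k where lk: "I = dyadic_interval l k" "l \<le> N" "k < 2 ^ l"
      by (rule dyadic_intervals_cases)
    have "(\<Sum>J\<in>{J \<in> ?D. J \<subseteq> I}. (y J)\<^sup>2 * measure lborel J)
        \<le> (real N + 1 / 2 ^ N) * measure lborel I"
    \<comment> \<open>The bound on the sum of squares matters only on the unit interval. An interval
      of level \<open>l \<ge> 1\<close> contains intervals of at most \<open>N\<close> levels, so
      squares bounded by 1 suffice there.\<close>
    proof (cases "l = 0")
      case True
      with lk have "{J \<in> ?D. J \<subseteq> I} = ?D"
        using dyadic_intervals_subset_root by auto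
      then show ?thesis
        using sum_dyadic_weights_le[of N "\<lambda>J. (y J)\<^sup>2"] y_le y_sum True lk by simp
    next
      case False
      have "(\<Sum>J\<in>{J \<in> ?D. J \<subseteq> I}. (y J)\<^sup>2 * measure lborel J)
          \<le> (\<Sum>J\<in>{J \<in> ?D. J \<subseteq> I}. 1 * measure lborel J)"
        using y_le by (intro sum_mono mult_right_mono) auto
      also have "\<dots> \<le> (real (N + 1) - real l) / 2 ^ l"
        using sum_measure_subset_le[of l N k] lk by simp
      also have "\<dots> \<le> (real N + 1 / 2 ^ N) / 2 ^ l"
      proof (rule divide_right_mono)
        have "real (N + 1) - real l \<le> real N"
          using False by simp
        also have "\<dots> \<le> real N + 1 / 2 ^ N"
          by simp
        finally show "real (N + 1) - real l \<le> real N + 1 / 2 ^ N" .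
      qed simp
      finally show ?thesis
        by (simp add: lk)
    qed
    then show "(\<Sum>J\<in>{J \<in> ?D. J \<subseteq> I}. (y J)\<^sup>2 * measure lborel J)
        \<le> (sqrt (real N + 1 / 2 ^ N))\<^sup>2 * measure lborel I"
      by simp
  qed
  then show ?thesis
    by (simp only: x rearrangement_op_haar_sum[OF bij] y_def)
qed

text \<open>Provides the nonemptiness that the supremum in \<open>bmo_opnorm\<close>
  requires.\<close>

lemma zero_in_BMO_ball: "haar_sum N (\<lambda>_. 0) \<in> {f \<in> BMO N. bmo_norm N f \<le> 1}"
  by (auto simp: BMO_def bmo_norm_le_iff)

lemma bmo_opnorm_rearrangement_le:
  assumes "bij_betw \<tau> (dyadic_intervals N) (dyadic_intervals N)"
  shows "bmo_opnorm N (rearrangement_op N \<tau>) \<le> sqrt (real N + 1 / 2 ^ N)"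
  unfolding bmo_opnorm_def
  using zero_in_BMO_ball bmo_norm_rearrangement_le[OF assms] by (intro cSUP_least) blast+

text \<open>A real supremum dominates its members once the family is bounded above; the uniform
  bound over the unit ball supplies this.\<close>

lemma bmo_norm_le_bmo_opnorm:
  assumes "bij_betw \<tau> (dyadic_intervals N) (dyadic_intervals N)"
    and "f \<in> BMO N" "bmo_norm N f \<le> 1"
  shows "bmo_norm N (rearrangement_op N \<tau> f) \<le> bmo_opnorm N (rearrangement_op N \<tau>)"
  unfolding bmo_opnorm_def
proof (rule cSUP_upper)
  show "bdd_above ((\<lambda>f. bmo_norm N (rearrangement_op N \<tau> f)) ` {f \<in> BMO N. bmo_norm N f \<le> 1})"
    using bmo_norm_rearrangement_le[OF assms(1)] by (intro bdd_aboveI2) blast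
qed (use assms in auto)

lemma max_rearrangement_norm_le: "max_rearrangement_norm N \<le> sqrt (real N + 1 / 2 ^ N)"
  unfolding max_rearrangement_norm_def
  using bij_betw_id by (intro cSUP_least) (auto intro: bmo_opnorm_rearrangement_le)

lemma bmo_opnorm_le_max_rearrangement_norm:
  assumes "bij_betw \<tau> (dyadic_intervals N) (dyadic_intervals N)"
  shows "bmo_opnorm N (rearrangement_op N \<tau>) \<le> max_rearrangement_norm N"
  unfolding max_rearrangement_norm_def
proof (rule cSUP_upper)
  show "bdd_above ((\<lambda>\<tau>. bmo_opnorm N (rearrangement_op N \<tau>)) `
      {\<tau>. bij_betw \<tau> (dyadic_intervals N) (dyadic_intervals N)})"
    using bmo_opnorm_rearrangement_le by (intro bdd_aboveI2) blast
qed (use assms in auto)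

section \<open>Lower bounds from the finest level\<close>

definition finest_level_indicator :: "nat \<Rightarrow> real set \<Rightarrow> real" where
  "finest_level_indicator N I = (if \<exists>k. I = dyadic_interval N k then 1 else 0)"

text \<open>The level-\<open>N\<close> intervals inside \<open>I\<close> are disjoint and have total
  length at most that of \<open>I\<close>, which is the Carleson condition with constant 1.\<close>

lemma bmo_norm_finest_level_le: "bmo_norm N (haar_sum N (finest_level_indicator N)) \<le> 1"
proof (subst bmo_norm_le_iff, simp, rule ballI)
  fix I assume "I \<in> dyadic_intervals N"
  then obtain l k where I: "I = dyadic_interval l k" "l \<le> N" "k < 2 ^ l"
    by (rule dyadic_intervals_cases)
  let ?K = "{k'. dyadic_interval N k' \<subseteq> I}"
  have sub: "?K \<subseteq> {..<2 ^ N}"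
  proof clarify
    fix k' assume "dyadic_interval N k' \<subseteq> I"
    also have "I \<subseteq> dyadic_interval 0 0"
      using \<open>I \<in> dyadic_intervals N\<close> by (rule dyadic_intervals_subset_root)
    finally have "real (k' + 1) \<le> real (2 ^ N)"
      by (simp add: dyadic_interval_subset_iff)
    then show "k' < 2 ^ N"
      by (simp only: of_nat_le_iff Suc_le_eq flip: Suc_eq_plus1)
  qed
  have "(\<Sum>J\<in>{J \<in> dyadic_intervals N. J \<subseteq> I}. (finest_level_indicator N J)\<^sup>2 * measure lborel J) =
      (\<Sum>J\<in>dyadic_interval N ` ?K. (finest_level_indicator N J)\<^sup>2 * measure lborel J)"
    using sub by (intro sum.mono_neutral_right) (auto simp: finest_level_indicator_def)
  also have "\<dots> = (\<Sum>k'\<in>?K. 1 / 2 ^ N)"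
    by (subst sum.reindex) (auto simp: inj_on_def finest_level_indicator_def)
  also have "\<dots> \<le> measure lborel I"
    using sum_measure_level_subset_le[of N l k] by (simp add: I)
  finally show "(\<Sum>J\<in>{J \<in> dyadic_intervals N. J \<subseteq> I}.
      (finest_level_indicator N J)\<^sup>2 * measure lborel J) \<le> 1\<^sup>2 * measure lborel I"
    by simp
qed

text \<open>Lower bounds for the operator norm come from \<open>f = \<Sum>\<^sub>k h\<^bsub>N,k\<^esub>\<close>, a function of norm at
  most 1, tested on the unit interval.\<close>

lemma max_rearrangement_norm_le_sqrt2_bmo_opnorm:
  assumes bij: "bij_betw \<tau> (dyadic_intervals N) (dyadic_intervals N)"
    and sum: "1 + real N / 2 \<le>
      (\<Sum>J\<in>dyadic_intervals N. (finest_level_indicator N (inv_into (dyadic_intervals N) \<tau> J))\<^sup>2 *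
        measure lborel J)"
  shows "1 / sqrt 2 * max_rearrangement_norm N \<le> bmo_opnorm N (rearrangement_op N \<tau>)"
proof -
  let ?D = "dyadic_intervals N" and ?c = "bmo_opnorm N (rearrangement_op N \<tau>)"
  let ?f = "haar_sum N (finest_level_indicator N)"
  have nonneg: "0 \<le> ?c"
  proof -
    have "0 \<le> bmo_norm N (rearrangement_op N \<tau> ?f)"
      unfolding bmo_norm_def
      by (intro cSUP_upper2[where x = "dyadic_interval 0 0"] bdd_above_finite)
        (auto intro!: sum_nonneg)
    also have "\<dots> \<le> ?c"
      using bij bmo_norm_finest_level_le by (intro bmo_norm_le_bmo_opnorm) (auto simp: BMO_def)
    finally show ?thesis .
  qed
  have "bmo_norm N (haar_sum N (\<lambda>J. finest_level_indicator N (inv_into ?D \<tau> J))) \<le> ?c"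
    using bmo_norm_le_bmo_opnorm[OF bij _ bmo_norm_finest_level_le]
    by (simp add: BMO_def rearrangement_op_haar_sum[OF bij])
  moreover have "{J \<in> ?D. J \<subseteq> dyadic_interval 0 0} = ?D"
    using dyadic_intervals_subset_root by auto
  moreover have "dyadic_interval 0 0 \<in> ?D"
    by simp
  ultimately have "(\<Sum>J\<in>?D. (finest_level_indicator N (inv_into ?D \<tau> J))\<^sup>2 * measure lborel J) \<le> ?c\<^sup>2"
    unfolding bmo_norm_le_iff[OF nonneg] by fastforce
  with sum have "1 + real N / 2 \<le> ?c\<^sup>2"
    by linarith
  \<comment> \<open>The upper bound for the squared maximal norm, halved, is at most
    \<open>(N + 1) / 2\<close>, which lies below \<open>1 + N / 2\<close>.\<close>
  moreover have "(real N + 1 / 2 ^ N) / 2 \<le> (real N + 1) / 2"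
    by (intro divide_right_mono add_left_mono) simp_all
  ultimately have "(real N + 1 / 2 ^ N) / 2 \<le> ?c\<^sup>2"
    by argo
  then have "sqrt ((real N + 1 / 2 ^ N) / 2) \<le> ?c"
    using nonneg by (simp add: real_le_lsqrt)
  moreover have "1 / sqrt 2 * max_rearrangement_norm N \<le> 1 / sqrt 2 * sqrt (real N + 1 / 2 ^ N)"
    by (intro mult_left_mono max_rearrangement_norm_le) simp
  ultimately show ?thesis
    by (simp add: real_sqrt_divide)
qed

section \<open>Positions in the postorder and the lexicographic order\<close>

text \<open>A strictly larger element has a strictly larger set of predecessors, so positions are
  injective; counting then gives surjectivity. The order axioms are relativised to \<open>A\<close>
  because neither order is linear on all sets of reals.\<close>

lemma bij_betw_position:
  assumes fin: "finite A"
    and refl: "\<And>a. a \<in> A \<Longrightarrow> le a a"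
    and trans: "\<And>a b c. a \<in> A \<Longrightarrow> b \<in> A \<Longrightarrow> c \<in> A \<Longrightarrow> le a b \<Longrightarrow> le b c \<Longrightarrow> le a c"
    and antisym: "\<And>a b. a \<in> A \<Longrightarrow> b \<in> A \<Longrightarrow> le a b \<Longrightarrow> le b a \<Longrightarrow> a = b"
    and total: "\<And>a b. a \<in> A \<Longrightarrow> b \<in> A \<Longrightarrow> le a b \<or> le b a"
  shows "bij_betw (position le A) A {1..card A}"
proof -
  have less: "position le A a < position le A b"
    if "a \<in> A" "b \<in> A" "le a b" "a \<noteq> b" for a b
    unfolding position_def
  proof (rule psubset_card_mono)
    show "{c \<in> A. le c a} \<subset> {c \<in> A. le c b}"
      using that refl[OF that(2)] trans[OF _ that(1,2)] antisym[OF that(1,2)] by blast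
  qed (simp add: fin)
  have inj: "inj_on (position le A) A"
    by (rule inj_onI) (metis less total less_irrefl)
  moreover have "position le A ` A = {1..card A}"
  proof (rule card_subset_eq)
    show "position le A ` A \<subseteq> {1..card A}"
    proof clarify
      fix a assume a: "a \<in> A"
      have "{c \<in> A. le c a} \<noteq> {}"
        using a refl by blast
      then show "position le A a \<in> {1..card A}"
        using fin by (auto simp: position_def Suc_le_eq card_gt_0_iff intro: card_mono)
    qed
  qed (simp_all add: card_image[OF inj])
  ultimately show ?thesis
    by (simp add: bij_betw_def)
qed

lemma nth_element_position:
  assumes "bij_betw (position le A) A {1..card A}" "n \<in> {1..card A}"
  shows "nth_element le A n \<in> A" "position le A (nth_element le A n) = n"
proof -
  have "\<exists>!a. a \<in> A \<and> position le A a = n"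
    using assms unfolding bij_betw_def inj_on_def by (metis imageE)
  from theI'[OF this] show "nth_element le A n \<in> A" "position le A (nth_element le A n) = n"
    by (simp_all add: nth_element_def)
qed

lemma bij_betw_position_postorder:
  "bij_betw (position postorder_le (dyadic_intervals N)) (dyadic_intervals N)
    {1..card (dyadic_intervals N)}"
proof (rule bij_betw_position)
  have ne: "I \<noteq> {}" if "I \<in> dyadic_intervals N" for I
    using that dyadic_interval_nonempty by (metis dyadic_intervals_cases)
  have left_iff: "postorder_le I J \<longleftrightarrow> (\<forall>x\<in>I. \<forall>y\<in>J. x < y) \<or> I \<subseteq> J" for I J
    by (auto simp: postorder_le_def)
  {
    fix I J assume "I \<in> dyadic_intervals N" "J \<in> dyadic_intervals N"
    then show "postorder_le I J \<or> postorder_le J I"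
      using dyadic_intervals_trichotomy[of I N J] by (auto simp: left_iff)
  next
    fix I J assume IJ: "I \<in> dyadic_intervals N" "J \<in> dyadic_intervals N"
      "postorder_le I J" "postorder_le J I"
    obtain i j where "i \<in> I" "j \<in> J"
      using ne IJ by blast
    then show "I = J"
      using IJ unfolding left_iff by (meson less_asym less_irrefl subset_antisym subsetD)
  next
    \<comment> \<open>Only the case \<open>I\<close> left of \<open>J\<close>,
      \<open>J \<subseteq> K\<close> needs more than chaining. There a point of \<open>J\<close>
      also lies in \<open>K\<close>, which rules out both \<open>K \<subseteq> I\<close> (unless
      equal) and \<open>K\<close> left of a nonempty \<open>I\<close>, so trichotomy leaves the
      desired alternatives.\<close>
    fix I J K assume D: "I \<in> dyadic_intervals N" "J \<in> dyadic_intervals N" "K \<in> dyadic_intervals N"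
      and le: "postorder_le I J" "postorder_le J K"
    obtain j where j: "j \<in> J"
      using ne D by blast
    from le show "postorder_le I K"
      unfolding left_iff
      using dyadic_intervals_trichotomy[OF D(1,3)] j
      by (smt (verit) less_trans less_irrefl less_asym subsetD subsetI)
  }
qed (auto simp: postorder_le_def)

lemma lex_le_dyadic_interval:
  "lex_le (dyadic_interval l k) (dyadic_interval l' k') \<longleftrightarrow> l < l' \<or> l = l' \<and> k \<le> k'"
  by (auto simp: lex_le_def)

lemma bij_betw_position_lex:
  "bij_betw (position lex_le (dyadic_intervals N)) (dyadic_intervals N)
    {1..card (dyadic_intervals N)}"
  by (rule bij_betw_position) (auto simp: lex_le_dyadic_interval elim!: dyadic_intervals_cases)

text \<open>The heap numbering of a binary tree: the coarser levels contribute
  \<open>2 ^ l - 1\<close> intervals and the level itself \<open>k + 1\<close>. The level can thus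
  be read off from the position, which lies between \<open>2 ^ l\<close> and
  \<open>2 ^ (l + 1) - 1\<close>.\<close>

lemma position_lex_dyadic_interval:
  assumes "l \<le> N" "k < 2 ^ l"
  shows "position lex_le (dyadic_intervals N) (dyadic_interval l k) = 2 ^ l + k"
proof -
  let ?S = "(SIGMA l':{..<l}. {..<2 ^ l'}) \<union> {l} \<times> {..k}"
  have "{I \<in> dyadic_intervals N. lex_le I (dyadic_interval l k)} =
      (\<lambda>(l, k). dyadic_interval l k) ` ?S"
    using assms by (auto simp: dyadic_intervals_eq_image lex_le_dyadic_interval image_iff)
  then have "position lex_le (dyadic_intervals N) (dyadic_interval l k) = card ?S"
    by (simp only: position_def card_image[OF inj_on_dyadic_interval])
  also have "\<dots> = card (SIGMA l':{..<l}. {..<(2::nat) ^ l'}) + card ({l} \<times> {..k})"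
    by (intro card_Un_disjoint) auto
  also have "\<dots> = (\<Sum>l'<l. 2 ^ l') + (k + 1)"
    by simp
  also have "\<dots> = 2 ^ l + k"
    by (simp add: lessThan_atLeast0 sum_power2)
  finally show ?thesis .
qed

lemma position_postorder_rearrangement:
  assumes "I \<in> dyadic_intervals N"
  shows "postorder_rearrangement N I \<in> dyadic_intervals N"
    and "position lex_le (dyadic_intervals N) (postorder_rearrangement N I) =
      position postorder_le (dyadic_intervals N) I"
  using nth_element_position[OF bij_betw_position_lex, of "position postorder_le (dyadic_intervals N) I" N]
    bij_betwE[OF bij_betw_position_postorder] assms
  by (auto simp: postorder_rearrangement_def)

lemma bij_betw_postorder_rearrangement:
  "bij_betw (postorder_rearrangement N) (dyadic_intervals N) (dyadic_intervals N)"
proof -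
  have "inj_on (postorder_rearrangement N) (dyadic_intervals N)"
    by (rule inj_onI)
      (metis position_postorder_rearrangement(2) bij_betw_position_postorder bij_betw_def inj_onD)
  moreover have "postorder_rearrangement N ` dyadic_intervals N \<subseteq> dyadic_intervals N"
    using position_postorder_rearrangement(1) by blast
  ultimately show ?thesis
    by (simp add: bij_betw_def endo_inj_surj)
qed

section \<open>Position estimates and the lengths they yield\<close>

lemma sum_div_power2_le: "(\<Sum>i\<le>n. k div 2 ^ i) \<le> 2 * (k::nat)"
proof (induction n arbitrary: k)
  case (Suc n)
  \<comment> \<open>Splitting off the term \<open>k\<close> leaves the same sum for
    \<open>k div 2\<close>, to which the induction hypothesis applies.\<close>
  have "(\<Sum>i\<le>Suc n. k div 2 ^ i) = k + (\<Sum>i\<le>n. k div 2 div 2 ^ i)"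
    by (subst sum.atMost_Suc_shift) (simp add: div_mult2_eq)
  also have "\<dots> \<le> k + 2 * (k div 2)"
    using Suc by simp
  finally show ?case
    by linarith
qed simp

text \<open>Besides the interval itself, only the \<open>k div 2 ^ (N - l)\<close> intervals of each level \<open>l\<close> that
  end before it precede \<open>I\<^bsub>N,k\<^esub>\<close> in postorder.\<close>

lemma position_postorder_finest_level_le:
  "position postorder_le (dyadic_intervals N) (dyadic_interval N k) \<le> 2 * k + 1"
proof -
  let ?S = "SIGMA l:{..N}. {..<k div 2 ^ (N - l)}"
  have "{I \<in> dyadic_intervals N. postorder_le I (dyadic_interval N k)} \<subseteq>
      insert (dyadic_interval N k) ((\<lambda>(l, k). dyadic_interval l k) ` ?S)"
  proof clarify
    fix I assume I: "I \<in> dyadic_intervals N" "postorder_le I (dyadic_interval N k)"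
      and notin: "I \<notin> (\<lambda>(l, k). dyadic_interval l k) ` ?S"
    obtain l j where lj: "I = dyadic_interval l j" "l \<le> N"
      using I(1) by (rule dyadic_intervals_cases)
    obtain d where N: "N = l + d"
      using lj(2) le_Suc_ex by blast
    have j: "k div 2 ^ d \<le> j"
      using notin lj by (auto simp: image_iff N)
    have k: "k < (k div 2 ^ d + 1) * 2 ^ d"
      using dividend_less_div_times[of "2 ^ d" k] by simp
    also have "\<dots> \<le> (j + 1) * 2 ^ d"
      using j by (intro mult_right_mono) auto
    finally have "real (k + 1) \<le> real ((j + 1) * 2 ^ d)"
      by (simp only: of_nat_le_iff)
    then have right: "(real k + 1) / 2 ^ N \<le> (real j + 1) / 2 ^ l"
      unfolding N divide_power2_le_iff by (simp add: algebra_simps)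
    show "I = dyadic_interval N k"
      using I(2) unfolding postorder_le_def
    proof (elim disjE conjE)
      assume left: "\<forall>x\<in>I. \<forall>y\<in>dyadic_interval N k. x < y"
      \<comment> \<open>A point of \<open>I\<close> that is not to the left of the interval of index
        \<open>k\<close>, available because \<open>I\<close> ends no earlier than that
        interval.\<close>
      define p where "p = max (real j / 2 ^ l) (real k / 2 ^ N)"
      have "real j / 2 ^ l < (real j + 1) / 2 ^ l" "real k / 2 ^ N < (real k + 1) / 2 ^ N"
        by (simp_all add: divide_strict_right_mono)
      then have "p \<in> I" "real k / 2 ^ N \<in> dyadic_interval N k"
        using right by (auto simp: p_def lj dyadic_interval_def)
      with left show ?thesis
        by (force simp: p_def)
    next
      assume sub: "I \<subseteq> dyadic_interval N k"
      then have "l = N"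
        using lj dyadic_interval_subset_level le_antisym by blast
      then show ?thesis
        using sub by (simp add: lj dyadic_interval_subset_iff divide_le_cancel)
    qed
  qed
  then have "position postorder_le (dyadic_intervals N) (dyadic_interval N k) \<le>
      card (insert (dyadic_interval N k) ((\<lambda>(l, k). dyadic_interval l k) ` ?S))"
    unfolding position_def by (intro card_mono) auto
  also have "\<dots> \<le> Suc (card ((\<lambda>(l, k). dyadic_interval l k) ` ?S))"
    by (rule card_insert_le_m1[of "Suc _", simplified]) simp_all
  also have "\<dots> = Suc (\<Sum>l\<le>N. k div 2 ^ (N - l))"
    by (simp add: card_image[OF inj_on_dyadic_interval])
  also have "(\<Sum>l\<le>N. k div 2 ^ (N - l)) = (\<Sum>i\<le>N. k div 2 ^ i)"
    by (rule sum.nat_diff_reindex[of _ "Suc N", simplified lessThan_Suc_atMost, simplified])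
  finally show ?thesis
    using sum_div_power2_le[of k N] by linarith
qed

text \<open>The condition \<open>2 ^ l \<le> 2 * k + 1\<close> singles out the unit interval and the intervals contained in
  its right half; all of them come after the \<open>2 ^ N - 1\<close> intervals contained in the left half.\<close>

lemma position_postorder_ge:
  assumes "l \<le> N" "k < 2 ^ l" "2 ^ l \<le> 2 * k + 1"
  shows "2 ^ N \<le> position postorder_le (dyadic_intervals N) (dyadic_interval l k)"
proof -
  \<comment> \<open>The first \<open>2 ^ m\<close> intervals of level \<open>Suc m\<close> are those
    in the left half of the unit interval, which gives \<open>2 ^ N - 1\<close> in all. The interval
    in question is the one that completes \<open>2 ^ N\<close>.\<close>
  let ?S = "SIGMA l:{..<N}. {..<(2::nat) ^ l}"
  let ?L = "(\<lambda>(l, k). dyadic_interval (Suc l) k) ` ?S"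
  have notin: "dyadic_interval l k \<notin> ?L"
    using assms(3) by auto
  have left: "postorder_le (dyadic_interval (Suc m) j) (dyadic_interval l k)"
    if "m < N" "j < 2 ^ m" for m j
  proof (cases "l = 0")
    case True
    have "dyadic_interval (Suc m) j \<subseteq> dyadic_interval 0 0"
      using that by (intro dyadic_intervals_subset_root[of _ N]) auto
    then show ?thesis
      using True assms by (simp add: postorder_le_def)
  next
    case False
    then have "2 ^ l \<le> 2 * k"
      using assms(3) by (cases l) auto
    then have "real (2 ^ l) \<le> real (2 * k)"
      by (simp only: of_nat_le_iff)
    then have k: "1 / 2 \<le> real k / 2 ^ l"
      by (simp add: field_simps)
    have "real (j + 1) \<le> real (2 ^ m)"
      using that(2) by (simp only: of_nat_le_iff Suc_le_eq flip: Suc_eq_plus1)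
    then have "(real j + 1) / 2 ^ Suc m \<le> 1 / 2"
      by (simp add: field_simps)
    then have "\<forall>x\<in>dyadic_interval (Suc m) j. \<forall>y\<in>dyadic_interval l k. x < y"
      using k unfolding dyadic_interval_def
      by (metis atLeastLessThan_iff less_le_trans order_trans)
    then show ?thesis
      by (auto simp: postorder_le_def)
  qed
  have "insert (dyadic_interval l k) ?L \<subseteq>
      {I \<in> dyadic_intervals N. postorder_le I (dyadic_interval l k)}"
    using assms by (auto intro: left simp: postorder_le_def[of "dyadic_interval l k"])
  then have "card (insert (dyadic_interval l k) ?L) \<le>
      position postorder_le (dyadic_intervals N) (dyadic_interval l k)"
    unfolding position_def by (intro card_mono) auto
  moreover have "card (insert (dyadic_interval l k) ?L) = Suc (card ?L)"
    using notin by simp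
  moreover have "card ?L = card ?S"
    by (intro card_image) (auto simp: inj_on_def)
  moreover have "card ?S = 2 ^ N - 1"
    by (simp add: lessThan_atLeast0 sum_power2)
  ultimately show ?thesis
    by simp
qed

text \<open>Dyadic condensation, as for the harmonic series: the term at 0 is at least 1, and each
  block from \<open>2 ^ n\<close> to \<open>2 ^ Suc n - 1\<close> has \<open>2 ^ n\<close> terms of
  size at least \<open>1 / 2 ^ Suc n\<close>.\<close>

lemma sum_dyadic_decay_ge:
  fixes g :: "nat \<Rightarrow> real"
  assumes "\<And>k m. m \<le> n \<Longrightarrow> k < 2 ^ m \<Longrightarrow> 1 / 2 ^ m \<le> g k"
  shows "1 + real n / 2 \<le> (\<Sum>k<2 ^ n. g k)"
  using assms
proof (induction n)
  case 0
  then show ?case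
    using 0[of 0 0] by simp
next
  case (Suc n)
  have "1 / 2 = (\<Sum>k\<in>{2 ^ n..<(2::nat) ^ Suc n}. 1 / (2::real) ^ Suc n)"
    by simp
  also have "\<dots> \<le> (\<Sum>k\<in>{2 ^ n..<2 ^ Suc n}. g k)"
    using Suc.prems[of "Suc n"] by (intro sum_mono) simp
  finally have "1 / 2 \<le> (\<Sum>k\<in>{2 ^ n..<2 ^ Suc n}. g k)" .
  moreover have "1 + real n / 2 \<le> (\<Sum>k<2 ^ n. g k)"
    using Suc by simp
  moreover have "(\<Sum>k<2 ^ Suc n. g k) = (\<Sum>k<2 ^ n. g k) + (\<Sum>k\<in>{2 ^ n..<2 ^ Suc n}. g k)"
    by (simp only: lessThan_atLeast0) (rule sum.atLeastLessThan_concat[symmetric]; simp)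
  ultimately show ?case
    by (simp only: of_nat_Suc add_divide_distrib)
qed

text \<open>For \<open>k < 2 ^ m\<close> the postorder position of the \<open>k\<close>-th finest
  interval is at most \<open>2 * k + 1 < 2 ^ Suc m\<close>. By heap numbering its image has level at
  most \<open>m\<close>, so the image lengths decay slowly enough for
  \<open>sum_dyadic_decay_ge\<close>.\<close>

lemma postorder_rearrangement_sum_ge:
  "1 + real N / 2 \<le>
    (\<Sum>J\<in>dyadic_intervals N. (finest_level_indicator N
        (inv_into (dyadic_intervals N) (postorder_rearrangement N) J))\<^sup>2 * measure lborel J)"
proof -
  let ?D = "dyadic_intervals N" and ?\<tau> = "postorder_rearrangement N"
  have decay: "1 / 2 ^ m \<le> measure lborel (?\<tau> (dyadic_interval N k))" if "m \<le> N" "k < 2 ^ m" for k m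
  proof -
    have "k < 2 ^ N"
      using that by (meson less_le_trans one_le_numeral power_increasing)
    then have I: "dyadic_interval N k \<in> ?D"
      by simp
    obtain l j where lj: "?\<tau> (dyadic_interval N k) = dyadic_interval l j" "l \<le> N" "j < 2 ^ l"
      using position_postorder_rearrangement(1)[OF I] by (rule dyadic_intervals_cases)
    have "2 ^ l + j \<le> 2 * k + 1"
      using position_postorder_rearrangement(2)[OF I] position_postorder_finest_level_le[of N k] lj
      by (simp add: position_lex_dyadic_interval)
    then have "(2::nat) ^ l < 2 ^ Suc m"
      using that(2) by simp
    then have "l \<le> m"
      using power_less_imp_less_exp[of "2::nat" l "Suc m"] by simp
    then show ?thesis
      by (simp add: lj divide_left_mono)
  qed
  have "1 + real N / 2 \<le> (\<Sum>k<2 ^ N. measure lborel (?\<tau> (dyadic_interval N k)))"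
    by (rule sum_dyadic_decay_ge) (rule decay)
  also have "\<dots> = (\<Sum>I\<in>dyadic_interval N ` {..<2 ^ N}.
      (finest_level_indicator N I)\<^sup>2 * measure lborel (?\<tau> I))"
    by (subst sum.reindex) (auto simp: inj_on_def finest_level_indicator_def)
  also have "\<dots> \<le> (\<Sum>I\<in>?D. (finest_level_indicator N I)\<^sup>2 * measure lborel (?\<tau> I))"
    by (intro sum_mono2) auto
  also have "\<dots> = (\<Sum>I\<in>?D. (finest_level_indicator N (inv_into ?D ?\<tau> (?\<tau> I)))\<^sup>2 * measure lborel (?\<tau> I))"
    using bij_betw_postorder_rearrangement[of N]
    by (intro sum.cong) (auto simp: bij_betw_inv_into_left)
  also have "\<dots> = (\<Sum>J\<in>?D. (finest_level_indicator N (inv_into ?D ?\<tau> J))\<^sup>2 * measure lborel J)"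
    by (rule sum.reindex_bij_betw[OF bij_betw_postorder_rearrangement])
  finally show ?thesis .
qed

text \<open>The unit interval and the intervals in its right half have postorder position at least
  \<open>2 ^ N\<close>, so by heap numbering their images have level \<open>N\<close>. They
  contribute length 1 at level 0 and \<open>1 / 2\<close> at every later level.\<close>

lemma inverse_postorder_rearrangement_sum_ge:
  "1 + real N / 2 \<le>
    (\<Sum>J\<in>dyadic_intervals N.
      (finest_level_indicator N (postorder_rearrangement N J))\<^sup>2 * measure lborel J)"
proof -
  let ?D = "dyadic_intervals N" and ?\<tau> = "postorder_rearrangement N"
  have one: "finest_level_indicator N (?\<tau> (dyadic_interval l k)) = 1"
    if "l \<le> N" "k < 2 ^ l" "2 ^ l \<le> 2 * k + 1" for l k
  proof -
    have I: "dyadic_interval l k \<in> ?D"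
      using that by simp
    obtain m j where mj: "?\<tau> (dyadic_interval l k) = dyadic_interval m j" "m \<le> N" "j < 2 ^ m"
      using position_postorder_rearrangement(1)[OF I] by (rule dyadic_intervals_cases)
    have "2 ^ N \<le> 2 ^ m + j"
      using position_postorder_rearrangement(2)[OF I] position_postorder_ge[OF that] mj
      by (simp add: position_lex_dyadic_interval)
    then have "(2::nat) ^ N < 2 ^ Suc m"
      using mj(3) by simp
    then have "m = N"
      using power_less_imp_less_exp[of "2::nat" N "Suc m"] mj(2) by simp
    then show ?thesis
      using mj(1) by (auto simp: finest_level_indicator_def)
  qed
  have level: "(if l = 0 then 1 else 1 / 2) \<le>
      (\<Sum>k<2 ^ l. (finest_level_indicator N (?\<tau> (dyadic_interval l k)))\<^sup>2 * (1 / 2 ^ l))"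
    if "l \<le> N" for l
  proof (cases l)
    case 0
    then show ?thesis
      using one[of 0 0] by simp
  next
    case (Suc m)
    \<comment> \<open>These indices are the intervals of level \<open>l = Suc m\<close> in the right
      half.\<close>
    have "1 / 2 = (\<Sum>k\<in>{2 ^ m..<(2::nat) ^ l}. 1 / (2::real) ^ l)"
      by (simp add: Suc)
    also have "\<dots> = (\<Sum>k\<in>{2 ^ m..<(2::nat) ^ l}.
        (finest_level_indicator N (?\<tau> (dyadic_interval l k)))\<^sup>2 * (1 / 2 ^ l))"
      using that by (intro sum.cong) (auto simp: one Suc)
    also have "\<dots> \<le> (\<Sum>k<2 ^ l.
        (finest_level_indicator N (?\<tau> (dyadic_interval l k)))\<^sup>2 * (1 / 2 ^ l))"
      by (intro sum_mono2) auto
    finally show ?thesis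
      by (simp add: Suc)
  qed
  have "1 + real N / 2 = (\<Sum>l\<le>N. if l = 0 then 1 else 1 / 2)"
    by (induction N) (auto simp: add_divide_distrib)
  also have "\<dots> \<le> (\<Sum>l\<le>N. \<Sum>k<2 ^ l.
      (finest_level_indicator N (?\<tau> (dyadic_interval l k)))\<^sup>2 * (1 / 2 ^ l))"
    by (intro sum_mono level) simp
  also have "\<dots> = (\<Sum>J\<in>?D. (finest_level_indicator N (?\<tau> J))\<^sup>2 * measure lborel J)"
    by (simp add: sum_dyadic_intervals)
  finally show ?thesis .
qed

theorem mainTheorem1:
  fixes N :: nat and \<tau> \<sigma> :: "real set \<Rightarrow> real set"
  defines "\<tau> \<equiv> postorder_rearrangement N"
  defines "\<sigma> \<equiv> inv_into (dyadic_intervals N) \<tau>"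
  shows "\<forall>T \<in> {rearrangement_op N \<tau>, rearrangement_op N \<sigma>}.
           1 / sqrt 2 * max_rearrangement_norm N \<le> bmo_opnorm N T \<and>
           bmo_opnorm N T \<le> max_rearrangement_norm N"
proof -
  let ?D = "dyadic_intervals N"
  have \<tau>: "bij_betw \<tau> ?D ?D"
    unfolding \<tau>_def by (rule bij_betw_postorder_rearrangement)
  then have \<sigma>: "bij_betw \<sigma> ?D ?D"
    unfolding \<sigma>_def by (rule bij_betw_inv_into)
  \<comment> \<open>Inverting twice recovers \<open>\<tau>\<close> on \<open>?D\<close>, so the
    coefficients of the image under the operator of \<open>\<sigma>\<close> are expressed through
    \<open>\<tau>\<close>.\<close>
  have "inv_into ?D \<sigma> J = \<tau> J" if "J \<in> ?D" for J
    unfolding \<sigma>_def using \<tau> that by (rule inv_into_inv_into_eq)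
  then have "(\<Sum>J\<in>?D. (finest_level_indicator N (inv_into ?D \<sigma> J))\<^sup>2 * measure lborel J) =
      (\<Sum>J\<in>?D. (finest_level_indicator N (\<tau> J))\<^sup>2 * measure lborel J)"
    by (intro sum.cong) auto
  then have "1 / sqrt 2 * max_rearrangement_norm N \<le> bmo_opnorm N (rearrangement_op N \<sigma>)"
    using inverse_postorder_rearrangement_sum_ge[of N]
    by (intro max_rearrangement_norm_le_sqrt2_bmo_opnorm[OF \<sigma>]) (simp add: \<tau>_def)
  moreover have "1 / sqrt 2 * max_rearrangement_norm N \<le> bmo_opnorm N (rearrangement_op N \<tau>)"
    using postorder_rearrangement_sum_ge[of N]
    by (intro max_rearrangement_norm_le_sqrt2_bmo_opnorm[OF \<tau>]) (simp add: \<tau>_def)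
  ultimately show ?thesis
    using bmo_opnorm_le_max_rearrangement_norm[OF \<tau>] bmo_opnorm_le_max_rearrangement_norm[OF \<sigma>]
    by simp
qed

end
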